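(* Let $s$, $t$ and $\ell$ be integers with $\ell \geq 0$ and $3.5\ell + 2 \leq s \leq t$. Let $G$ be a multigraph and let $L(G)$ denote its line graph. If $\chi(L(G)) = s+t-1 > \omega(L(G))$, then $L(G)$ contains a clique $Q$ of size $s$ such that $\chi(L(G) - Q) \geq t + \ell$.
   Context: A multigraph may have multiple edges between the same pair of vertices. The line graph $L(G)$ of a multigraph $G$ has vertex set $E(G)$, two distinct edges being adjacent in $L(G)$ if and only if they share at least one endpoint. $\chi(H)$ denotes the chromatic number and $\omega(H)$ the clique number (size of a largest clique) of a graph $H$; $L(G)-Q$ denotes the graph obtained from $L(G)$ by deleting the vertices of $Q$. *)

theory Defs
  imports Complex_Main "HOL-Library.Ramsey"
begin

text \<open>Simple graphs: edges are two-element sets of vertices, so that \<open>clique\<close> from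
  \<open>HOL-Library.Ramsey\<close> applies to the edge set.\<close>

record 'a ugraph =
  uverts :: "'a set"
  uedges :: "'a set set"

definition clique_of :: "'a ugraph \<Rightarrow> 'a set \<Rightarrow> bool" where
  "clique_of H Q \<longleftrightarrow> Q \<subseteq> uverts H \<and> clique Q (uedges H)"

definition clique_number :: "'a ugraph \<Rightarrow> nat" where
  "clique_number H = Max {card Q |Q. clique_of H Q}"

definition proper_colouring :: "'a ugraph \<Rightarrow> nat \<Rightarrow> ('a \<Rightarrow> nat) \<Rightarrow> bool" where
  "proper_colouring H k c \<longleftrightarrow>
     (\<forall>v\<in>uverts H. c v < k) \<and>
     (\<forall>u\<in>uverts H. \<forall>v\<in>uverts H. {u, v} \<in> uedges H \<longrightarrow> c u \<noteq> c v)"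

definition chromatic_number :: "'a ugraph \<Rightarrow> nat" where
  "chromatic_number H = (LEAST k. \<exists>c. proper_colouring H k c)"

definition delete_verts :: "'a ugraph \<Rightarrow> 'a set \<Rightarrow> 'a ugraph" where
  "delete_verts H Q = \<lparr>uverts = uverts H - Q, uedges = {d \<in> uedges H. d \<inter> Q = {}}\<rparr>"

text \<open>Finite loopless multigraphs: edges are abstract objects, and \<open>ends\<close> maps an edge to
  its pair of endpoints; it need not be injective.\<close>

locale multigraph =
  fixes V :: "'v set" and E :: "'e set" and ends :: "'e \<Rightarrow> 'v set"
  assumes finite_verts: "finite V"
    and finite_edges: "finite E"
    and ends_subset: "e \<in> E \<Longrightarrow> ends e \<subseteq> V"
    and card_ends: "e \<in> E \<Longrightarrow> card (ends e) = 2"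

definition line_graph :: "'e set \<Rightarrow> ('e \<Rightarrow> 'v set) \<Rightarrow> 'e ugraph" where
  "line_graph E ends =
     \<lparr>uverts = E,
      uedges = {{e, f} |e f. e \<in> E \<and> f \<in> E \<and> e \<noteq> f \<and> ends e \<inter> ends f \<noteq> {}}\<rparr>"

end

theory Submission
  imports Defs
begin

text \<open>
  Put \<open>k = s + t - 2\<close>, so that the edges of \<open>G\<close> cannot be coloured with \<open>k\<close> colours while all stars
  and triangles have at most \<open>k\<close> edges. Some vertex \<open>x\<close> has degree at least \<open>s\<close>, for otherwise a
  greedy colouring succeeds. Let \<open>Q\<close> consist of \<open>s\<close> edges at \<open>x\<close> and suppose that \<open>G - Q\<close> is
  coloured with \<open>t + l - 1\<close> colours. The \<open>s - l - 1\<close> unused colours are put on one edge of \<open>Q\<close> each,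
  so \<open>l + 1\<close> edges remain uncoloured, and the new colours are ``rare'': they occur only at \<open>x\<close>.

  A rare colour \<open>c\<close> is missing at all vertices but two. Let \<open>xy\<close> be uncoloured and \<open>xz\<close> have
  colour \<open>c\<close>. By Vizing fans and Kempe changes, either one more edge can be coloured or every colour
  missing at one of \<open>x\<close>, \<open>y\<close>, \<open>z\<close> occurs on the opposite side of the triangle. As the triangle
  has at most \<open>k\<close> edges, in the second case some colour \<open>d\<close> occurs at all three vertices but not inside
  the triangle; giving colour \<open>c\<close> to the \<open>d\<close>-edge at \<open>y\<close> or \<open>z\<close> makes the fan larger, and a second
  rare colour then allows one more edge to be coloured. So each step uses up at most two rare
  colours, and \<open>s \<ge> 3 l + 3\<close> suffices to colour all of \<open>G\<close>. The hypothesis allows one further case,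
  \<open>l = 0\<close> and \<open>s = 2\<close>, with a single rare colour: there a vertex of degree \<open>k\<close> is dealt with
  directly, and if there is none, then colours are missing at both \<open>y\<close> and \<open>z\<close>, and a Kempe change
  along the \<open>d\<close>-chain leaving the triangle for good takes the place of the second rare colour.
\<close>

section \<open>Colouring line graphs\<close>

lemma line_graph_adj:
  assumes "e \<in> E" "f \<in> E"
  shows "{e, f} \<in> uedges (line_graph E ends) \<longleftrightarrow> e \<noteq> f \<and> ends e \<inter> ends f \<noteq> {}"
  using assms by (auto simp: line_graph_def doubleton_eq_iff)

lemma proper_colouring_line_graph:
  "proper_colouring (line_graph E ends) k c \<longleftrightarrow>
     (\<forall>e\<in>E. c e < k) \<and> (\<forall>e\<in>E. \<forall>f\<in>E. e \<noteq> f \<longrightarrow> ends e \<inter> ends f \<noteq> {} \<longrightarrow> c e \<noteq> c f)"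
proof -
  have "uverts (line_graph E ends) = E" by (simp add: line_graph_def)
  then show ?thesis by (simp add: proper_colouring_def line_graph_adj imp_conjL cong: ball_cong)
qed

lemma delete_verts_line_graph: "delete_verts (line_graph E ends) Q = line_graph (E - Q) ends"
  by (auto simp: delete_verts_def line_graph_def)

lemma clique_of_line_graph:
  "clique_of (line_graph E ends) Q \<longleftrightarrow>
     Q \<subseteq> E \<and> (\<forall>e\<in>Q. \<forall>f\<in>Q. e \<noteq> f \<longrightarrow> ends e \<inter> ends f \<noteq> {})"
proof -
  have "uverts (line_graph E ends) = E" by (simp add: line_graph_def)
  then have "clique_of (line_graph E ends) Q \<longleftrightarrow>
      Q \<subseteq> E \<and> (\<forall>e\<in>Q. \<forall>f\<in>Q. e \<noteq> f \<longrightarrow> {e, f} \<in> uedges (line_graph E ends))"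
    by (simp add: clique_of_def clique_def)
  also have "\<dots> \<longleftrightarrow> Q \<subseteq> E \<and> (\<forall>e\<in>Q. \<forall>f\<in>Q. e \<noteq> f \<longrightarrow> ends e \<inter> ends f \<noteq> {})"
  proof (intro conj_cong refl ball_cong imp_cong)
    fix e f
    assume "Q \<subseteq> E" "e \<in> Q" "f \<in> Q" "e \<noteq> f"
    then show "{e, f} \<in> uedges (line_graph E ends) \<longleftrightarrow> ends e \<inter> ends f \<noteq> {}"
      using line_graph_adj[of e E f ends] by (simp add: subsetD)
  qed
  finally show ?thesis .
qed

lemma chromatic_number_le: "proper_colouring H k c \<Longrightarrow> chromatic_number H \<le> k"
  unfolding chromatic_number_def by (rule Least_le) blast

lemma line_graph_colouring:
  assumes "finite E" "chromatic_number (line_graph E ends) \<le> k"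
  obtains c where "proper_colouring (line_graph E ends) k c"
proof -
  obtain h where "bij_betw h E {0..<card E}" using ex_bij_betw_finite_nat[OF assms(1)] by blast
  then have "proper_colouring (line_graph E ends) (card E) h"
    unfolding proper_colouring_line_graph bij_betw_def inj_on_def by fastforce
  then have "\<exists>j c. proper_colouring (line_graph E ends) j c" by blast
  from LeastI_ex[OF this]
  obtain c where "proper_colouring (line_graph E ends) (chromatic_number (line_graph E ends)) c"
    unfolding chromatic_number_def by blast
  then have "proper_colouring (line_graph E ends) k c"
    using assms(2) unfolding proper_colouring_line_graph by force
  then show thesis using that by blast
qed

lemma card_le_clique_number:
  assumes "finite E" "clique_of (line_graph E ends) Q"
  shows "card Q \<le> clique_number (line_graph E ends)"
proof -
  have "{card Q |Q. clique_of (line_graph E ends) Q} \<subseteq> card ` Pow E"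
    by (auto simp: clique_of_line_graph)
  then have "finite {card Q |Q. clique_of (line_graph E ends) Q}"
    using assms(1) by (meson finite_Pow_iff finite_imageI finite_subset)
  then show ?thesis unfolding clique_number_def using assms(2) by (intro Max_ge) auto
qed

text \<open>Insert the edges of \<open>E - A\<close> one at a time: \<open>deg\<close> counts
  neighbours in all of \<open>E\<close>, so a colour is free whatever was inserted before.\<close>

lemma greedy_extension:
  assumes "finite E" "A \<subseteq> E" "proper_colouring (line_graph A ends) k c"
    and deg: "\<And>e. e \<in> E - A \<Longrightarrow> card {f \<in> E. f \<noteq> e \<and> ends e \<inter> ends f \<noteq> {}} < k"
  shows "\<exists>c. proper_colouring (line_graph E ends) k c"
proof -
  have "\<exists>c. proper_colouring (line_graph (A \<union> F) ends) k c" if "finite F" "F \<subseteq> E - A" for F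
    using that
  proof (induction F rule: finite_induct)
    case empty
    then show ?case using assms by auto
  next
    case (insert e F)
    then obtain c where c: "proper_colouring (line_graph (A \<union> F) ends) k c" by blast
    let ?N = "{f \<in> A \<union> F. f \<noteq> e \<and> ends e \<inter> ends f \<noteq> {}}"
    have fin: "finite {f \<in> E. f \<noteq> e \<and> ends e \<inter> ends f \<noteq> {}}" using assms(1) by simp
    have "?N \<subseteq> {f \<in> E. f \<noteq> e \<and> ends e \<inter> ends f \<noteq> {}}" using insert.prems assms(2) by blast
    then have N: "card ?N < k" "finite ?N"
      using deg[of e] insert.prems card_mono[OF fin] finite_subset[OF _ fin]
      by (auto intro: le_less_trans)
    then have "card (c ` ?N) < card {..<k}" using card_image_le[OF N(2), of c] by simp
    then have "\<not> {..<k} \<subseteq> c ` ?N" using N(2) card_mono[of "c ` ?N" "{..<k}"] by auto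
    then obtain a where a: "a < k" "a \<notin> c ` ?N" by blast
    have "e \<notin> A \<union> F" using insert by blast
    then have "proper_colouring (line_graph (A \<union> insert e F) ends) k (c(e := a))"
      using c a unfolding proper_colouring_line_graph by (auto simp: Int_commute)
    then show ?case by blast
  qed
  from this[of "E - A"] show ?thesis using assms(1,2) by (simp add: Un_absorb1)
qed

section \<open>Kempe changes\<close>

text \<open>\<open>P\<close> is the orbit of \<open>r\<close> under both involutions. As
  \<open>a\<close> fixes \<open>r\<close>, a single walk \<open>r\<close>, \<open>b r\<close>,
  \<open>a (b r)\<close>, ... traces it, and this walk can come to a stop at one vertex
  only.\<close>

lemma alternating_orbit:
  fixes a b :: "'a \<Rightarrow> 'a"
  assumes a: "\<And>v. a (a v) = v" and b: "\<And>v. b (b v) = v" and r: "a r = r"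
  obtains P where "r \<in> P" "\<And>v. v \<in> P \<Longrightarrow> a v \<in> P" "\<And>v. v \<in> P \<Longrightarrow> b v \<in> P"
    "\<And>y z. \<lbrakk>y \<in> P; z \<in> P; b y = y \<or> (a y = y \<and> y \<noteq> r); b z = z \<or> (a z = z \<and> z \<noteq> r)\<rbrakk> \<Longrightarrow> y = z"
proof -
  define step where "step i = (if even i then b else a)" for i :: nat
  define w where "w = rec_nat r step"
  have w0: "w 0 = r" by (simp add: w_def)
  have wS: "w (Suc i) = step i (w i)" for i by (simp add: w_def)
  have prev: "step i (w (Suc i)) = w i" for i
    by (simp add: wS step_def a b)
  \<comment> \<open>\<open>I\<close> holds the indices reached before the walk first stands still;
    beyond that it would only retrace itself.\<close>
  define I where "I = {i. \<forall>j<i. w (Suc j) \<noteq> w j}"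
  have I0: "0 \<in> I" by (simp add: I_def)
  have Idown: "i \<in> I" if "Suc i \<in> I" for i using that by (auto simp: I_def)
  have Istep: "w (Suc i) \<in> w ` I" if "i \<in> I" for i
  proof (cases "w (Suc i) = w i")
    case False
    then have "Suc i \<in> I" using that by (auto simp: I_def less_Suc_eq)
    then show ?thesis by blast
  qed (use that in auto)
  \<comment> \<open>At \<open>w m\<close> one involution leads forward along the walk and the other
    back; for \<open>m = 0\<close> the backward one is \<open>a\<close>, which fixes
    \<open>r\<close>.\<close>
  have closed: "step i (w m) \<in> w ` I" if "m \<in> I" for i m
  proof (cases "even i = even m")
    case True
    then have "step i = step m" by (simp add: step_def)
    then show ?thesis using Istep[OF that] by (simp add: wS)
  next
    case False
    show ?thesis
    proof (cases m)
      case 0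
      then have "step i = a" using False by (simp add: step_def)
      then show ?thesis using 0 I0 r w0 by force
    next
      case (Suc j)
      then have "step i = step j" using False by (simp add: step_def)
      then have "step i (w m) = w j" using prev Suc by simp
      then show ?thesis using that Suc Idown by blast
    qed
  qed
  \<comment> \<open>The step into \<open>w m\<close> moved, so the involution fixing
    \<open>w m\<close> is the one due next. At \<open>r\<close> only \<open>b\<close> counts, and
    \<open>b\<close> is the first step.\<close>
  have stuck: "w (Suc m) = w m"
    if "m \<in> I" and fixed: "b (w m) = w m \<or> (a (w m) = w m \<and> w m \<noteq> r)" for m
  proof (cases m)
    case 0
    then show ?thesis using fixed w0 wS[of 0] by (auto simp: step_def)
  next
    case (Suc j)
    have "w (Suc j) \<noteq> w j" using that Suc by (auto simp: I_def)
    then have "step j (w m) \<noteq> w m" using prev[of j] Suc by simp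
    then show ?thesis using fixed Suc wS[of m] by (auto simp: step_def split: if_splits)
  qed
  show ?thesis
  proof
    show "r \<in> w ` I" using I0 w0 by force
    show "a v \<in> w ` I" if "v \<in> w ` I" for v
      using that closed[of _ 1] by (auto simp: step_def)
    show "b v \<in> w ` I" if "v \<in> w ` I" for v
      using that closed[of _ 0] by (auto simp: step_def)
    fix y z
    assume "y \<in> w ` I" "z \<in> w ` I"
      and fixed: "b y = y \<or> (a y = y \<and> y \<noteq> r)" "b z = z \<or> (a z = z \<and> z \<noteq> r)"
    then obtain m n where mn: "m \<in> I" "n \<in> I" "y = w m" "z = w n" by blast
    then have "w (Suc m) = w m" "w (Suc n) = w n" using stuck fixed by auto
    then have "\<not> m < n" "\<not> n < m" using mn by (auto simp: I_def)
    then show "y = z" using mn by simp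
  qed
qed

text \<open>\<open>k\<close> is the number of colours and \<open>x\<close> the vertex where all
  uncoloured edges will meet. The clique number enters through two kinds of cliques, stars and
  triangles.\<close>

locale clique_bounded_multigraph = multigraph V E ends
  for V :: "'v set" and E :: "'e set" and ends :: "'e \<Rightarrow> 'v set" +
  fixes k :: nat and x :: 'v
  assumes star_le: "card {e \<in> E. v \<in> ends e} \<le> k"
    and triangle_le: "card {e \<in> E. ends e \<subseteq> {a, b, c}} \<le> k"
begin

text \<open>
  A colour \<open>f e \<ge> k\<close> encodes that \<open>e\<close> is uncoloured; all uncoloured edges meet at \<open>x\<close>.
\<close>

definition partial_colouring :: "('e \<Rightarrow> nat) \<Rightarrow> bool" where
  "partial_colouring f \<longleftrightarrow>
     (\<forall>e\<in>E. \<forall>e'\<in>E. e \<noteq> e' \<longrightarrow> ends e \<inter> ends e' \<noteq> {} \<longrightarrow> f e = f e' \<longrightarrow> k \<le> f e) \<and>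
     (\<forall>e\<in>E. k \<le> f e \<longrightarrow> x \<in> ends e)"

definition uncoloured :: "('e \<Rightarrow> nat) \<Rightarrow> 'e set" where
  "uncoloured f = {e \<in> E. k \<le> f e}"

definition missing :: "('e \<Rightarrow> nat) \<Rightarrow> 'v \<Rightarrow> nat set" where
  "missing f v = {c. c < k \<and> (\<forall>e\<in>E. v \<in> ends e \<longrightarrow> f e \<noteq> c)}"

definition rare :: "('e \<Rightarrow> nat) \<Rightarrow> nat \<Rightarrow> bool" where
  "rare f c \<longleftrightarrow> c < k \<and> (\<forall>e\<in>E. f e = c \<longrightarrow> x \<in> ends e)"

text \<open>
  The set \<open>B\<close> bounds the rare colours that are used up.
\<close>

definition augmentable :: "('e \<Rightarrow> nat) \<Rightarrow> nat set \<Rightarrow> bool" where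
  "augmentable f B \<longleftrightarrow> (\<exists>g. partial_colouring g \<and> card (uncoloured g) < card (uncoloured f) \<and> (\<forall>c. rare f c \<longrightarrow> c \<notin> B \<longrightarrow> rare g c))"

lemma finite_uncoloured [simp]: "finite (uncoloured f)"
  using finite_edges by (simp add: uncoloured_def)

lemma augmentable_mono: "augmentable f B \<Longrightarrow> B \<subseteq> C \<Longrightarrow> augmentable f C"
  unfolding augmentable_def by blast

lemma augmentable_trans:
  assumes "augmentable g B" "card (uncoloured g) = card (uncoloured f)"
    "\<And>c. rare f c \<Longrightarrow> c \<notin> C \<Longrightarrow> rare g c" "B \<subseteq> C"
  shows "augmentable f C"
  using assms unfolding augmentable_def by (metis subsetD)

lemma ends_pair:
  assumes "e \<in> E" "v \<in> ends e"
  obtains w where "ends e = {v, w}" "w \<noteq> v"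
proof -
  obtain p q where "ends e = {p, q}" "p \<noteq> q"
    using card_ends[OF assms(1)] by (meson card_2_iff)
  then show thesis using that[of p] that[of q] assms(2) by auto
qed

lemma ends_distinct: "e \<in> E \<Longrightarrow> ends e = {v, w} \<Longrightarrow> v \<noteq> w"
  using card_ends by force

lemma partial_colouring_eq:
  assumes "partial_colouring f" "e \<in> E" "e' \<in> E" "v \<in> ends e" "v \<in> ends e'" "f e = f e'" "f e < k"
  shows "e = e'"
  using assms unfolding partial_colouring_def by (metis disjoint_iff not_le)

lemma missingD: "c \<in> missing f v \<Longrightarrow> e \<in> E \<Longrightarrow> v \<in> ends e \<Longrightarrow> f e \<noteq> c"
  by (simp add: missing_def)

lemma miss_less: "c \<in> missing f v \<Longrightarrow> c < k"
  by (simp add: missing_def)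

lemma rare_less: "rare f c \<Longrightarrow> c < k"
  by (simp add: rare_def)

lemma not_missingE:
  assumes "c \<notin> missing f v" "c < k"
  obtains e w where "e \<in> E" "ends e = {v, w}" "w \<noteq> v" "f e = c"
  using assms ends_pair unfolding missing_def by blast

lemma uncolouredE:
  assumes "partial_colouring f" "u \<in> uncoloured f"
  obtains z where "ends u = {x, z}" "z \<noteq> x"
  using assms ends_pair[of u x] unfolding partial_colouring_def uncoloured_def by blast

section \<open>Missing colours and fan shifts\<close>

lemma card_miss: "k \<le> card (missing f v) + card {e \<in> E. v \<in> ends e \<and> f e < k}"
proof -
  let ?S = "{e \<in> E. v \<in> ends e \<and> f e < k}"
  have "{..<k} \<subseteq> missing f v \<union> f ` ?S" by (auto simp: missing_def)
  moreover have fin: "finite ?S" using finite_edges by simp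
  moreover have "finite (missing f v)" by (simp add: missing_def)
  ultimately have "card {..<k} \<le> card (missing f v \<union> f ` ?S)" by (intro card_mono) auto
  also have "\<dots> \<le> card (missing f v) + card (f ` ?S)" by (rule card_Un_le)
  also have "\<dots> \<le> card (missing f v) + card ?S" using card_image_le[OF fin] by simp
  finally show ?thesis by simp
qed

lemma card_coloured_star:
  assumes "u \<in> uncoloured f" "v \<in> ends u"
  shows "card {e \<in> E. v \<in> ends e \<and> f e < k} < card {e \<in> E. v \<in> ends e}"
proof (rule psubset_card_mono)
  have "u \<in> {e \<in> E. v \<in> ends e}" "u \<notin> {e \<in> E. v \<in> ends e \<and> f e < k}"
    using assms by (auto simp: uncoloured_def)
  then show "{e \<in> E. v \<in> ends e \<and> f e < k} \<subset> {e \<in> E. v \<in> ends e}" by blast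
qed (use finite_edges in simp)

lemma miss_nonempty:
  assumes "u \<in> uncoloured f" "v \<in> ends u"
  shows "missing f v \<noteq> {}"
proof
  assume "missing f v = {}"
  then show False
    using card_miss[of f v] card_coloured_star[OF assms] star_le[of v] by simp
qed

lemma rare_miss_everywhere:
  assumes "rare f c" "c \<in> missing f x"
  shows "c \<in> missing f v"
  using assms by (auto simp: rare_def missing_def)

lemma partial_colouring_upd:
  assumes f: "partial_colouring f" and e: "e \<in> E" "ends e = {v, w}" and c: "c \<in> missing f v" "c \<in> missing f w"
  shows "partial_colouring (f(e := c))"
proof -
  have no: "f e' \<noteq> c" if "e' \<in> E" "ends e \<inter> ends e' \<noteq> {}" for e'
    using that e missingD[OF c(1), of e'] missingD[OF c(2), of e'] by auto
  have "k \<le> (f(e := c)) p" if "p \<in> E" "q \<in> E" "p \<noteq> q" "ends p \<inter> ends q \<noteq> {}"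
    "(f(e := c)) p = (f(e := c)) q" for p q
    using that no[of p] no[of q] f unfolding partial_colouring_def
    by (auto simp: Int_commute split: if_splits)
  then show ?thesis using f miss_less[OF c(1)] unfolding partial_colouring_def by auto
qed

text \<open>Only an edge at \<open>x\<close> is recoloured, so every rare colour stays rare; hence
  \<open>B\<close> is arbitrary.\<close>

lemma augmentable_direct:
  assumes f: "partial_colouring f" and u: "u \<in> uncoloured f" "ends u = {x, y}" and c: "c \<in> missing f x" "c \<in> missing f y"
  shows "augmentable f B"
  unfolding augmentable_def
proof (intro exI conjI allI impI)
  have uE: "u \<in> E" using u by (simp add: uncoloured_def)
  show "partial_colouring (f(u := c))" using partial_colouring_upd[OF f uE u(2) c] .
  have "uncoloured (f(u := c)) = uncoloured f - {u}" using miss_less[OF c(1)] by (auto simp: uncoloured_def)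
  then show "card (uncoloured (f(u := c))) < card (uncoloured f)"
    using u(1) finite_uncoloured[of f] by (metis card_Diff1_less)
  show "rare (f(u := c)) d" if "rare f d" for d
    using that u(2) by (auto simp: rare_def)
qed

text \<open>The basic fan move: the colour of \<open>v\<close> passes to \<open>u\<close>, and
  \<open>v\<close> becomes uncoloured, encoded by \<open>k\<close>. Both edges contain
  \<open>x\<close>, so no rare colour is lost.\<close>

lemma shift:
  assumes f: "partial_colouring f" and u: "u \<in> uncoloured f" "ends u = {x, y}"
    and v: "v \<in> E" "x \<in> ends v" "f v \<in> missing f y"
  defines "g \<equiv> f(u := f v, v := k)"
  shows "partial_colouring g" "card (uncoloured g) = card (uncoloured f)" "\<And>c. rare f c \<Longrightarrow> rare g c" "v \<in> uncoloured g"
proof -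
  have uE: "u \<in> E" and uk: "k \<le> f u" using u by (auto simp: uncoloured_def)
  have vk: "f v < k" using miss_less[OF v(3)] .
  have uv: "u \<noteq> v" using uk vk by auto
  have no: "f e \<noteq> f v" if "e \<in> E" "e \<noteq> v" "ends u \<inter> ends e \<noteq> {}" for e
    using that u(2) missingD[OF v(3)] partial_colouring_eq[OF f that(1) v(1) _ v(2)] vk by auto
  have conflict: "k \<le> g e" if "e \<in> E" "e' \<in> E" "e \<noteq> e'" "ends e \<inter> ends e' \<noteq> {}" "g e = g e'" for e e'
  proof (cases "e = v \<or> e' = v")
    case True
    then show ?thesis using that by (auto simp: g_def)
  next
    case False
    then show ?thesis
      using that no[of e] no[of e'] f unfolding partial_colouring_def g_def
      by (auto simp: Int_commute split: if_splits)
  qed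
  then show "partial_colouring g" using f v(2) vk unfolding partial_colouring_def g_def by auto
  have "uncoloured g = insert v (uncoloured f - {u})" using uv vk v(1) by (auto simp: uncoloured_def g_def)
  moreover have "v \<notin> uncoloured f" using vk by (simp add: uncoloured_def)
  ultimately show "card (uncoloured g) = card (uncoloured f)"
    using u(1) finite_uncoloured[of f] by (metis card_insert_disjoint card_Suc_Diff1 finite_Diff DiffD1)
  show "rare g c" if "rare f c" for c
    using that u(2) v(2) by (auto simp: rare_def g_def)
  show "v \<in> uncoloured g" using v(1) by (simp add: uncoloured_def g_def)
qed

section \<open>Kempe swaps and chains\<close>

definition kswap :: "'e set \<Rightarrow> nat \<Rightarrow> nat \<Rightarrow> ('e \<Rightarrow> nat) \<Rightarrow> 'e \<Rightarrow> nat" where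
  "kswap F c d f e = (if e \<in> F then if f e = c then d else if f e = d then c else f e else f e)"

text \<open>The condition on \<open>F\<close> makes its edges of colours \<open>c\<close> and
  \<open>d\<close> a union of whole Kempe components, so no conflict arises at the border.\<close>

lemma kswap:
  assumes f: "partial_colouring f" and cd: "c < k" "d < k"
    and F: "\<forall>e\<in>E \<inter> F. \<forall>e'\<in>E - F. ends e \<inter> ends e' \<noteq> {} \<longrightarrow> \<not> (f e \<in> {c, d} \<and> f e' \<in> {c, d})"
  shows "partial_colouring (kswap F c d f)" "uncoloured (kswap F c d f) = uncoloured f"
    "\<And>b. rare f b \<Longrightarrow> b \<notin> {c, d} \<Longrightarrow> rare (kswap F c d f) b"
proof -
  let ?g = "kswap F c d f"
  have lek: "k \<le> ?g e \<longleftrightarrow> k \<le> f e" for e using cd by (auto simp: kswap_def)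
  have "k \<le> ?g e" if *: "e \<in> E" "e' \<in> E" "e \<noteq> e'" "ends e \<inter> ends e' \<noteq> {}" "?g e = ?g e'" for e e'
  proof (cases "(e \<in> F) = (e' \<in> F)")
    case True
    then have "f e = f e'" using *(5) by (auto simp: kswap_def split: if_splits)
    then show ?thesis using * f lek unfolding partial_colouring_def by blast
  next
    case False
    have "f e = f e'"
    proof (rule ccontr)
      assume "f e \<noteq> f e'"
      then have "f e \<in> {c, d} \<and> f e' \<in> {c, d}"
        using *(5) False by (auto simp: kswap_def split: if_splits)
      then show False using F False * by (metis DiffI Int_commute IntI)
    qed
    then show ?thesis using * f lek unfolding partial_colouring_def by blast
  qed
  then show "partial_colouring ?g" using f lek unfolding partial_colouring_def by blast
  show "uncoloured ?g = uncoloured f" using lek by (simp add: uncoloured_def)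
  show "rare ?g b" if "rare f b" "b \<notin> {c, d}" for b
    using that by (auto simp: rare_def kswap_def split: if_splits)
qed

text \<open>With \<open>v\<close> itself as default value this becomes an involution for
  \<open>c < k\<close>, \<open>F \<subseteq> E\<close> and a partial colouring \<open>f\<close>, as
  \<open>alternating_orbit\<close> requires.\<close>

definition partner :: "'e set \<Rightarrow> ('e \<Rightarrow> nat) \<Rightarrow> nat \<Rightarrow> 'v \<Rightarrow> 'v" where
  "partner F f c v = (if \<exists>e\<in>F. v \<in> ends e \<and> f e = c
     then THE w. \<exists>e\<in>F. ends e = {v, w} \<and> f e = c else v)"

lemma partner_edge:
  assumes f: "partial_colouring f" and c: "c < k" and F: "F \<subseteq> E" and e: "e \<in> F" "ends e = {v, w}" "f e = c"
  shows "partner F f c v = w"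
proof -
  have "(THE w. \<exists>e\<in>F. ends e = {v, w} \<and> f e = c) = w"
  proof (rule the_equality)
    show "\<exists>e\<in>F. ends e = {v, w} \<and> f e = c" using e by blast
    fix w' assume "\<exists>e\<in>F. ends e = {v, w'} \<and> f e = c"
    then obtain e' where e': "e' \<in> F" "ends e' = {v, w'}" "f e' = c" by blast
    then have "e = e'" using partial_colouring_eq[OF f, of e e' v] e c F by auto
    then show "w' = w" using e e' by (metis doubleton_eq_iff)
  qed
  then show ?thesis using e unfolding partner_def by auto
qed

lemma partner_partner:
  assumes f: "partial_colouring f" and c: "c < k" and F: "F \<subseteq> E"
  shows "partner F f c (partner F f c v) = v"
proof (cases "\<exists>e\<in>F. v \<in> ends e \<and> f e = c")
  case True
  then obtain e where e: "e \<in> F" "v \<in> ends e" "f e = c" by blast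
  then obtain w where w: "ends e = {v, w}" using ends_pair F by blast
  then have w': "ends e = {w, v}" by auto
  show ?thesis
    using partner_edge[OF f c F e(1) w e(3)] partner_edge[OF f c F e(1) w' e(3)] by simp
next
  case False
  then have "partner F f c v = v" unfolding partner_def by (rule if_not_P)
  then show ?thesis by simp
qed

text \<open>\<open>P\<close> is the vertex set of the alternating path from \<open>x\<close> whose
  \<open>c\<close>-edges are taken from \<open>F\<close> only; such a path has at most one further
  end. The restriction to \<open>F\<close> later serves to ignore \<open>c\<close>-edges that meet a
  triangle.\<close>

lemma kempe_set:
  assumes f: "partial_colouring f" and cd: "c < k" "d < k" and F: "F \<subseteq> E"
    and x: "\<forall>e\<in>F. x \<in> ends e \<longrightarrow> f e \<noteq> c"
  obtains P where "x \<in> P"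
    "\<And>e. e \<in> F \<Longrightarrow> f e = c \<Longrightarrow> ends e \<subseteq> P \<or> ends e \<inter> P = {}"
    "\<And>e. e \<in> E \<Longrightarrow> f e = d \<Longrightarrow> ends e \<subseteq> P \<or> ends e \<inter> P = {}"
    "\<And>y z. \<lbrakk>y \<in> P; z \<in> P; d \<in> missing f y; d \<in> missing f z\<rbrakk> \<Longrightarrow> y = z"
    "\<And>y z. \<lbrakk>y \<in> P; z \<in> P; y \<noteq> x; z \<noteq> x; \<forall>e\<in>F. y \<in> ends e \<longrightarrow> f e \<noteq> c; \<forall>e\<in>F. z \<in> ends e \<longrightarrow> f e \<noteq> c\<rbrakk> \<Longrightarrow> y = z"
proof -
  let ?a = "partner F f c" and ?b = "partner E f d"
  have fixed: "partner G f b v = v" if "\<forall>e\<in>G. v \<in> ends e \<longrightarrow> f e \<noteq> b" for G b v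
    using that by (auto simp: partner_def)
  obtain P where P: "x \<in> P" "\<And>v. v \<in> P \<Longrightarrow> ?a v \<in> P" "\<And>v. v \<in> P \<Longrightarrow> ?b v \<in> P"
    "\<And>y z. \<lbrakk>y \<in> P; z \<in> P; ?b y = y \<or> (?a y = y \<and> y \<noteq> x); ?b z = z \<or> (?a z = z \<and> z \<noteq> x)\<rbrakk> \<Longrightarrow> y = z"
  proof (rule alternating_orbit[of ?a ?b x])
    show "?a (?a v) = v" "?b (?b v) = v" for v
      using partner_partner[OF f cd(1) F] partner_partner[OF f cd(2) order_refl] by auto
    show "?a x = x" using fixed[OF x] .
  qed (use that in blast)
  have closed: "ends e \<subseteq> P \<or> ends e \<inter> P = {}"
    if G: "G \<subseteq> E" "\<And>v. v \<in> P \<Longrightarrow> partner G f b v \<in> P" and b: "b < k" and e: "e \<in> G" "f e = b" for G b e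
  proof (rule ccontr)
    assume "\<not> ?thesis"
    then obtain v where v: "v \<in> ends e" "v \<in> P" "\<not> ends e \<subseteq> P" by blast
    then obtain w where w: "ends e = {v, w}" using ends_pair G e by blast
    then show False using partner_edge[OF f b G(1) e(1) w e(2)] G(2) v by force
  qed
  show thesis
  proof (rule that[OF P(1)])
    show "ends e \<subseteq> P \<or> ends e \<inter> P = {}" if "e \<in> F" "f e = c" for e
      using closed[OF F P(2) cd(1) that] .
    show "ends e \<subseteq> P \<or> ends e \<inter> P = {}" if "e \<in> E" "f e = d" for e
      using closed[OF _ P(3) cd(2) that] by blast
    show "y = z" if "y \<in> P" "z \<in> P" "d \<in> missing f y" "d \<in> missing f z" for y z
      using that P(4)[of y z] fixed[of E _ d] missingD by metis
    show "y = z" if "y \<in> P" "z \<in> P" "y \<noteq> x" "z \<noteq> x" "\<forall>e\<in>F. y \<in> ends e \<longrightarrow> f e \<noteq> c"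
      "\<forall>e\<in>F. z \<in> ends e \<longrightarrow> f e \<noteq> c" for y z
      using that P(4)[of y z] fixed[of F _ c] by blast
  qed
qed

text \<open>Vizing's argument: let \<open>b\<close> be missing at \<open>x\<close>. As
  \<open>y\<close> and \<open>z\<close> both miss \<open>c\<close>, the
  \<open>b\<close>-\<open>c\<close> chain from \<open>x\<close> reaches at most one of them, and a
  swap frees \<open>b\<close> at the other.\<close>

lemma augmentable_kempe:
  assumes f: "partial_colouring f" and u: "u \<in> uncoloured f" "ends u = {x, y}" and w: "w \<in> E" "ends w = {x, z}"
    and yz: "y \<noteq> z" and fw: "f w \<in> missing f y" and c: "c \<in> missing f y" "c \<in> missing f z"
  shows "augmentable f {c}"
proof -
  have "missing f x \<noteq> {}" using miss_nonempty[OF u(1), of x] u(2) by blast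
  then obtain b where b: "b \<in> missing f x" by blast
  show ?thesis
  proof (cases "rare f b")
    case True
    then show ?thesis using augmentable_direct[OF f u b] rare_miss_everywhere b by blast
  next
    case nrare: False
    have bk: "b < k" and ck: "c < k" using b c miss_less by auto
    obtain P where P: "x \<in> P"
      "\<And>e. e \<in> E \<Longrightarrow> f e = b \<Longrightarrow> ends e \<subseteq> P \<or> ends e \<inter> P = {}"
      "\<And>e. e \<in> E \<Longrightarrow> f e = c \<Longrightarrow> ends e \<subseteq> P \<or> ends e \<inter> P = {}"
      "\<And>y z. \<lbrakk>y \<in> P; z \<in> P; c \<in> missing f y; c \<in> missing f z\<rbrakk> \<Longrightarrow> y = z"
    proof (rule kempe_set[OF f bk ck order_refl])
      show "\<forall>e\<in>E. x \<in> ends e \<longrightarrow> f e \<noteq> b" using missingD[OF b] by blast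
    qed (use that in blast)
    \<comment> \<open>All \<open>b\<close>-\<open>c\<close> chains avoiding \<open>P\<close> are
      swapped at once; the edges at \<open>x\<close>, in particular \<open>w\<close>, keep their
      colours.\<close>
    define F where "F = {e. ends e \<inter> P = {}}"
    define g where "g = kswap F b c f"
    have sep: "\<forall>e\<in>E \<inter> F. \<forall>e'\<in>E - F. ends e \<inter> ends e' \<noteq> {} \<longrightarrow> \<not> (f e \<in> {b, c} \<and> f e' \<in> {b, c})"
      using P(2,3) unfolding F_def by blast
    note g = kswap[OF f bk ck sep, folded g_def]
    have missP: "missing g v = missing f v" if "v \<in> P" for v
      using that unfolding missing_def g_def kswap_def F_def by auto
    have misso: "b \<in> missing g v" if v: "v \<notin> P" "c \<in> missing f v" for v
    proof -
      have "g e \<noteq> b" if e: "e \<in> E" "v \<in> ends e" for e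
      proof (cases "e \<in> F")
        case True
        then show ?thesis using missingD[OF v(2) e] by (auto simp: g_def kswap_def)
      next
        case False
        then show ?thesis using P(2)[OF e(1)] v e by (auto simp: g_def kswap_def F_def)
      qed
      then show ?thesis using bk by (simp add: missing_def)
    qed
    have bx: "b \<in> missing g x" using b missP P(1) by simp
    have "augmentable g {}"
    proof (cases "y \<in> P")
      case False
      then show ?thesis using augmentable_direct[OF g(1) _ u(2) bx misso] u(1) c(1) g(2) by blast
    next
      case True
      \<comment> \<open>Here \<open>b\<close> is free at \<open>z\<close>: shift the gap from
        \<open>u\<close> to \<open>w\<close> and give \<open>b\<close> to \<open>w\<close>.\<close>
      then have zP: "z \<notin> P" using P(4) c yz by blast
      have "w \<notin> F" using w P(1) by (auto simp: F_def)
      then have gw: "g w = f w" by (simp add: g_def kswap_def)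
      let ?h = "g(u := g w, w := k)"
      have sh: "partial_colouring ?h" "card (uncoloured ?h) = card (uncoloured g)" "\<And>d. rare g d \<Longrightarrow> rare ?h d" "w \<in> uncoloured ?h"
        using shift[OF g(1), of u y w] u w gw fw g(2) missP[OF True] by auto
      have "f w \<noteq> b" using missingD[OF b] w by auto
      then have "b \<in> missing ?h x" "b \<in> missing ?h z"
        using bx misso[OF zP c(2)] gw bk by (auto simp: missing_def)
      then have "augmentable ?h {}" using augmentable_direct[OF sh(1,4) w(2)] by blast
      then show ?thesis using augmentable_trans sh by blast
    qed
    \<comment> \<open>As \<open>b\<close> is not rare in this case, only \<open>c\<close> may lose
      its rarity.\<close>
    then show ?thesis using augmentable_trans[of g "{}" f "{c}"] g nrare by auto
  qed
qed

section \<open>Fans with a rare colour\<close>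

lemma rare_miss:
  assumes "partial_colouring f" "rare f c" "v \<in> E" "ends v = {x, z}" "f v = c" "w \<notin> {x, z}"
  shows "c \<in> missing f w"
proof -
  have "f e \<noteq> c" if e: "e \<in> E" "w \<in> ends e" for e
  proof
    assume fe: "f e = c"
    then have "x \<in> ends e" using assms(2) e by (auto simp: rare_def)
    then have "e = v" using partial_colouring_eq[OF assms(1) e(1) assms(3), of x] assms fe rare_less by auto
    then show False using e assms by auto
  qed
  then show ?thesis using rare_less[OF assms(2)] by (simp add: missing_def)
qed

text \<open>As \<open>v\<close> is the only edge of the rare colour \<open>c\<close>, this colour is
  missing at \<open>y\<close>; so \<open>u\<close>, \<open>v\<close> form a fan of length two at
  \<open>x\<close>.\<close>

definition fan_pair :: "('e \<Rightarrow> nat) \<Rightarrow> 'e \<Rightarrow> 'e \<Rightarrow> 'v \<Rightarrow> 'v \<Rightarrow> nat \<Rightarrow> bool" where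
  "fan_pair f u v y z c \<longleftrightarrow> partial_colouring f \<and> u \<in> uncoloured f \<and> v \<in> E \<and> ends u = {x, y} \<and> ends v = {x, z} \<and>
     y \<noteq> z \<and> f v = c \<and> rare f c"

lemma fan_pairD:
  assumes "fan_pair f u v y z c"
  shows "partial_colouring f" "u \<in> uncoloured f" "u \<in> E" "v \<in> E" "ends u = {x, y}" "ends v = {x, z}" "y \<noteq> z"
    "f v = c" "rare f c" "x \<noteq> y" "x \<noteq> z" "c < k" "u \<noteq> v"
proof -
  show *: "partial_colouring f" "u \<in> uncoloured f" "v \<in> E" "ends u = {x, y}" "ends v = {x, z}" "y \<noteq> z"
    "f v = c" "rare f c" using assms by (auto simp: fan_pair_def)
  show "u \<in> E" using *(2) by (simp add: uncoloured_def)
  then show "x \<noteq> y" "x \<noteq> z" using ends_distinct * by metis+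
  show "c < k" using rare_less * by blast
  show "u \<noteq> v" using * by (auto simp: doubleton_eq_iff)
qed

lemma fan_pair_miss: "fan_pair f u v y z c \<Longrightarrow> w \<notin> {x, z} \<Longrightarrow> c \<in> missing f w"
  using rare_miss fan_pairD by metis

text \<open>Shifting \<open>c\<close> from \<open>v\<close> to \<open>u\<close> reverses the fan, so
  facts about \<open>y\<close> have mirror images about \<open>z\<close>.\<close>

lemma fan_pair_swap:
  assumes "fan_pair f u v y z c"
  defines "g \<equiv> f(u := c, v := k)"
  shows "fan_pair g v u z y c" "augmentable g B \<Longrightarrow> augmentable f B" "\<And>d. rare f d \<Longrightarrow> rare g d"
    "\<And>d. d \<in> missing f z \<Longrightarrow> d \<in> missing g z"
proof -
  note D = fan_pairD[OF assms(1)]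
  have "c \<in> missing f y" using fan_pair_miss[OF assms(1)] D by auto
  then have sh: "partial_colouring g" "card (uncoloured g) = card (uncoloured f)" "\<And>c. rare f c \<Longrightarrow> rare g c" "v \<in> uncoloured g"
    using shift[OF D(1,2,5,4)] D unfolding g_def by auto
  show "fan_pair g v u z y c"
    using sh D by (auto simp: fan_pair_def g_def)
  show "augmentable f B" if "augmentable g B" using augmentable_trans[OF that sh(2)] sh(3) by blast
  show "rare g d" if "rare f d" for d using sh(3) that .
  show "d \<in> missing g z" if "d \<in> missing f z" for d
  proof -
    have "d \<noteq> c" "d < k" using missingD[OF that D(4)] miss_less[OF that] D by auto
    then show ?thesis using that unfolding missing_def g_def by auto
  qed
qed

text \<open>Some edge \<open>xa\<close> has colour \<open>d\<close>, else \<open>u\<close> could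
  take it. If \<open>a\<close> were not \<open>z\<close>, then \<open>y\<close> and \<open>a\<close>
  would both miss \<open>c\<close>, and \<open>augmentable_kempe\<close> would apply to
  \<open>xy\<close> and \<open>xa\<close>.\<close>

lemma miss_tail:
  assumes "fan_pair f u v y z c" "\<not> augmentable f {c}" "d \<in> missing f y" "d \<noteq> c"
  shows "\<exists>w\<in>E. ends w = {x, z} \<and> f w = d"
proof -
  note D = fan_pairD[OF assms(1)]
  have "d \<notin> missing f x" using augmentable_direct[OF D(1,2,5) _ assms(3)] assms(2) by blast
  then obtain w a where w: "w \<in> E" "ends w = {x, a}" "a \<noteq> x" "f w = d"
    using not_missingE miss_less[OF assms(3)] by metis
  have "a \<noteq> y" using missingD[OF assms(3) w(1)] w by auto
  have "a = z"
  proof (rule ccontr)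
    assume "a \<noteq> z"
    then have "c \<in> missing f a" "c \<in> missing f y"
      using fan_pair_miss[OF assms(1)] D w by auto
    then show False
      using augmentable_kempe[OF D(1,2,5) w(1,2)] \<open>a \<noteq> y\<close> w assms by metis
  qed
  then show ?thesis using w by blast
qed

lemma miss_head:
  assumes "fan_pair f u v y z c" "\<not> augmentable f {c}" "d \<in> missing f z"
  shows "\<exists>w\<in>E. ends w = {x, y} \<and> f w = d"
proof -
  note D = fan_pairD[OF assms(1)]
  let ?g = "f(u := c, v := k)"
  have "d \<noteq> c" using missingD[OF assms(3) D(4)] D by auto
  then obtain w where w: "w \<in> E" "ends w = {x, y}" "?g w = d"
    using miss_tail[OF fan_pair_swap(1)[OF assms(1)] _ fan_pair_swap(4)[OF assms(1,3)]]
      fan_pair_swap(2)[OF assms(1)] assms(2) by metis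
  moreover have "f w = d" using w \<open>d \<noteq> c\<close> miss_less[OF assms(3)] by (auto split: if_splits)
  ultimately show ?thesis by blast
qed

text \<open>Since \<open>c\<close> sits on \<open>v\<close> alone, an edge at \<open>y\<close>
  leaving the triangle can take it; this frees the old colour at \<open>y\<close> at the cost of the
  rarity of \<open>c\<close>.\<close>

lemma recolour_rare:
  assumes "fan_pair f u v y z c" "e \<in> E" "ends e = {y, a}" "a \<notin> {x, z}"
  defines "g \<equiv> f(e := c)"
  shows "partial_colouring g" "uncoloured g = uncoloured f" "\<And>d. rare f d \<Longrightarrow> d \<noteq> c \<Longrightarrow> rare g d"
    "f e \<in> missing g y" "\<And>d w. d \<in> missing f w \<Longrightarrow> d \<noteq> c \<Longrightarrow> d \<in> missing g w"
proof -
  note D = fan_pairD[OF assms(1)]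
  have c: "c \<in> missing f y" "c \<in> missing f a" using fan_pair_miss[OF assms(1)] D assms by auto
  show "partial_colouring g" unfolding g_def by (rule partial_colouring_upd[OF D(1) assms(2,3) c])
  have "y \<noteq> a" using ends_distinct assms by blast
  then have "x \<notin> ends e" using assms D by auto
  then have ek: "f e < k" using D(1) assms(2) unfolding partial_colouring_def by (metis not_le)
  then show "uncoloured g = uncoloured f" using D by (auto simp: uncoloured_def g_def)
  show "rare g d" if "rare f d" "d \<noteq> c" for d
    using that by (auto simp: rare_def g_def)
  have "f e \<noteq> c" using missingD[OF c(1) assms(2)] assms by auto
  moreover have "f e' \<noteq> f e" if "e' \<in> E" "y \<in> ends e'" "e' \<noteq> e" for e'
    using partial_colouring_eq[OF D(1) that(1) assms(2) that(2)] that ek assms(3) by auto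
  ultimately show "f e \<in> missing g y" using ek by (auto simp: missing_def g_def)
  show "d \<in> missing g w" if "d \<in> missing f w" "d \<noteq> c" for d w
    using that by (auto simp: missing_def g_def)
qed

text \<open>If the \<open>d\<close>-edge at \<open>y\<close> left the triangle, recolouring it with
  \<open>c\<close> would free \<open>d\<close> at \<open>y\<close>, and \<open>u\<close> could take
  \<open>d\<close>.\<close>

lemma miss_centre:
  assumes "fan_pair f u v y z c" "\<not> augmentable f {c}" "d \<in> missing f x"
  shows "\<exists>h\<in>E. ends h = {y, z} \<and> f h = d"
proof -
  note D = fan_pairD[OF assms(1)]
  have dc: "d \<noteq> c" using missingD[OF assms(3) D(4)] D by auto
  have "d \<notin> missing f y" using augmentable_direct[OF D(1,2,5) assms(3)] assms(2) by blast
  then obtain e a where e: "e \<in> E" "ends e = {y, a}" "a \<noteq> y" "f e = d"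
    using not_missingE miss_less[OF assms(3)] by metis
  have "a \<noteq> x" using missingD[OF assms(3) e(1)] e by auto
  have "a = z"
  proof (rule ccontr)
    assume "a \<noteq> z"
    then have "a \<notin> {x, z}" using \<open>a \<noteq> x\<close> by simp
    note R = recolour_rare[OF assms(1) e(1,2) this]
    let ?g = "f(e := c)"
    have "augmentable ?g {}"
      using augmentable_direct[OF R(1) _ D(5) R(5)[OF assms(3) dc]] R(2,4) D(2) e(4) by simp
    then show False using augmentable_trans[of ?g "{}" f "{c}"] R(2,3) assms(2) by auto
  qed
  then show ?thesis using e by blast
qed

text \<open>The triangle has at most \<open>k\<close> edges and \<open>u\<close> is uncoloured, so
  some colour is absent from it. By \<open>miss_centre\<close>, \<open>miss_tail\<close> and
  \<open>miss_head\<close>, a colour other than \<open>c\<close> that is missing at a corner would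
  occur inside.\<close>

lemma leaving_colour:
  assumes "fan_pair f u v y z c" "\<not> augmentable f {c}"
  obtains d where "d < k" "d \<noteq> c" "\<And>e. e \<in> E \<Longrightarrow> ends e \<subseteq> {x, y, z} \<Longrightarrow> f e \<noteq> d"
    "d \<notin> missing f x" "d \<notin> missing f y" "d \<notin> missing f z"
proof -
  note D = fan_pairD[OF assms(1)]
  let ?T = "{e \<in> E. ends e \<subseteq> {x, y, z}}"
  have fin: "finite ?T" using finite_edges by simp
  have u: "u \<in> ?T" "k \<le> f u" using D by (auto simp: uncoloured_def)
  have "\<not> {..<k} \<subseteq> f ` (?T - {u})"
  proof
    assume "{..<k} \<subseteq> f ` (?T - {u})"
    then have "card {..<k} \<le> card (f ` (?T - {u}))" using fin by (intro card_mono) auto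
    also have "\<dots> \<le> card (?T - {u})" using fin by (intro card_image_le) auto
    also have "\<dots> < card ?T" using fin u by (meson card_Diff1_less)
    finally show False using triangle_le[of x y z] by simp
  qed
  then obtain d where d: "d < k" "d \<notin> f ` (?T - {u})" by blast
  then have no: "f e \<noteq> d" if "e \<in> E" "ends e \<subseteq> {x, y, z}" for e
    using that u(2) by (cases "e = u") auto
  have dc: "d \<noteq> c" using no[of v] D by auto
  show thesis
  proof
    show "d \<notin> missing f x" using miss_centre[OF assms] no by fastforce
    show "d \<notin> missing f y" using miss_tail[OF assms] no dc by fastforce
    show "d \<notin> missing f z" using miss_head[OF assms] no by fastforce
  qed (use d dc no in auto)
qed

text \<open>A colour \<open>b\<close> leaves the triangle at \<open>x\<close> and at
  \<open>y\<close>. Giving \<open>c\<close> to its edge at \<open>y\<close> lets its edge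
  \<open>xa\<close> continue the fan, and \<open>d\<close> is then a colour missing at both
  \<open>y\<close> and \<open>a\<close>.\<close>

lemma augmentable_rare_tail:
  assumes "fan_pair f u v y z c" "rare f d" "d \<noteq> c" "d \<in> missing f y"
  shows "augmentable f {c, d}"
proof (rule ccontr)
  assume contr: "\<not> augmentable f {c, d}"
  then have ne: "\<not> augmentable f {c}" using augmentable_mono by blast
  note D = fan_pairD[OF assms(1)]
  obtain b where b: "b < k" "b \<noteq> c" "\<And>e. e \<in> E \<Longrightarrow> ends e \<subseteq> {x, y, z} \<Longrightarrow> f e \<noteq> b"
    "b \<notin> missing f x" "b \<notin> missing f y"
    using leaving_colour[OF assms(1) ne] by metis
  obtain w a where w: "w \<in> E" "ends w = {x, a}" "f w = b" using not_missingE b by metis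
  have a: "a \<notin> {x, y, z}" using b(3)[OF w(1)] w by auto
  obtain e a' where e: "e \<in> E" "ends e = {y, a'}" "f e = b" using not_missingE b by metis
  have a': "a' \<notin> {x, z}" using b(3)[OF e(1)] e by auto
  \<comment> \<open>The only edge of the rare colour \<open>d\<close> joins \<open>x\<close> and
    \<open>z\<close>, so \<open>d\<close> is missing at \<open>a\<close>.\<close>
  obtain v' where v': "v' \<in> E" "ends v' = {x, z}" "f v' = d"
    using miss_tail[OF assms(1) ne assms(4,3)] by blast
  have "d \<in> missing f a" using rare_miss[OF D(1) assms(2) v'] a by simp
  note R = recolour_rare[OF assms(1) e(1,2) a']
  let ?g = "f(e := c)"
  have "w \<noteq> e" using w e a D by (auto simp: doubleton_eq_iff)
  then have "?g w = b" using w by simp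
  moreover have "b \<in> missing ?g y" using R(4) e(3) by simp
  moreover have "d \<in> missing ?g y" "d \<in> missing ?g a" using R(5) assms(3,4) \<open>d \<in> missing f a\<close> by auto
  moreover have "u \<in> uncoloured ?g" "y \<noteq> a" using R(2) D(2) a by auto
  ultimately have "augmentable ?g {d}" using augmentable_kempe[OF R(1) _ D(5) w(1,2)] by simp
  then show False using augmentable_trans[of ?g "{d}" f "{c, d}"] R(2,3) contr by auto
qed

text \<open>If \<open>d\<close> is present at \<open>y\<close>, its only edge joins \<open>x\<close>
  and \<open>y\<close>, so \<open>d\<close> is missing at \<open>z\<close> and the reversed fan
  serves.\<close>

lemma augmentable_two_rare_pair:
  assumes "fan_pair f u v y z c" "rare f d" "d \<noteq> c"
  shows "augmentable f {c, d}"
proof (cases "d \<in> missing f y")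
  case True
  then show ?thesis using augmentable_rare_tail assms by blast
next
  case False
  note D = fan_pairD[OF assms(1)]
  obtain e a where e: "e \<in> E" "ends e = {y, a}" "f e = d"
    using not_missingE[OF False rare_less[OF assms(2)]] by metis
  then have "a = x" using assms(2) D by (auto simp: rare_def)
  then have "d \<in> missing f z" using rare_miss[OF D(1) assms(2) e(1) _ e(3)] e D by (auto simp: insert_commute)
  then show ?thesis
    using augmentable_rare_tail[OF fan_pair_swap(1)[OF assms(1)]] fan_pair_swap(2,3,4)[OF assms(1)] assms
    by blast
qed

lemma fan_pair_exists:
  assumes f: "partial_colouring f" and "uncoloured f \<noteq> {}" and c: "rare f c"
  obtains (direct) "\<And>B. augmentable f B"
  | (pair) g u v y z where "fan_pair g u v y z c" "\<And>B. augmentable g B \<Longrightarrow> augmentable f B" "\<And>d. rare f d \<Longrightarrow> rare g d"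
proof -
  obtain u where u: "u \<in> uncoloured f" using assms by blast
  then have uE: "u \<in> E" by (simp add: uncoloured_def)
  obtain y where y: "ends u = {x, y}" "y \<noteq> x" using uncolouredE[OF f u] by metis
  show thesis
  proof (cases "c \<in> missing f x")
    case True
    then show thesis using direct augmentable_direct[OF f u y(1) True] rare_miss_everywhere[OF c] by blast
  next
    case False
    then obtain v z where v: "v \<in> E" "ends v = {x, z}" "z \<noteq> x" "f v = c"
      using not_missingE rare_less[OF c] by metis
    show thesis
    proof (cases "y = z")
      case False
      then have "fan_pair f u v y z c" using f u v y c by (auto simp: fan_pair_def)
      then show thesis using pair by blast
    next
      case True
      \<comment> \<open>Here \<open>v\<close> is parallel to \<open>u\<close>. Unless
        \<open>u\<close> can be coloured at once, a shift along an edge whose colour is missing at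
        \<open>y\<close> moves the gap to another neighbour of \<open>x\<close>.\<close>
      obtain d where d: "d \<in> missing f y" using miss_nonempty[OF u, of y] y by blast
      show thesis
      proof (cases "d \<in> missing f x")
        case True
        then show thesis using direct augmentable_direct[OF f u y(1) True d] by blast
      next
        case False
        then obtain w a where w: "w \<in> E" "ends w = {x, a}" "a \<noteq> x" "f w = d"
          using not_missingE miss_less[OF d] by metis
        have ay: "a \<noteq> y" using missingD[OF d w(1)] w by auto
        let ?g = "f(u := f w, w := k)"
        have sh: "partial_colouring ?g" "card (uncoloured ?g) = card (uncoloured f)" "\<And>c. rare f c \<Longrightarrow> rare ?g c" "w \<in> uncoloured ?g"
          using shift[OF f u y(1) w(1)] w d by auto
        have "v \<noteq> u" using u v rare_less[OF c] by (auto simp: uncoloured_def)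
        moreover have "v \<noteq> w" using v w ay True by (auto simp: doubleton_eq_iff)
        ultimately have "fan_pair ?g w v a z c"
          using sh v w ay True c by (auto simp: fan_pair_def)
        then show thesis using pair[of ?g w v a z] augmentable_trans[of ?g] sh by blast
      qed
    qed
  qed
qed

lemma augmentable_two_rare:
  assumes "partial_colouring f" "uncoloured f \<noteq> {}" "rare f c" "rare f d" "d \<noteq> c"
  shows "augmentable f {c, d}"
  using assms(1-3)
proof (cases rule: fan_pair_exists)
  case (pair g u v y z)
  then show ?thesis using augmentable_two_rare_pair assms by blast
qed

lemma complete_colouring:
  assumes "partial_colouring f" "finite R" "\<And>c. c \<in> R \<Longrightarrow> rare f c" "2 * card (uncoloured f) \<le> card R"
  shows "\<exists>g. partial_colouring g \<and> uncoloured g = {}"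
  using assms
proof (induction "card (uncoloured f)" arbitrary: f R rule: less_induct)
  case less
  show ?case
  proof (cases "uncoloured f = {}")
    case False
    then have "0 < card (uncoloured f)" by (simp add: card_gt_0_iff)
    then have "2 \<le> card R" using less.prems(4) by simp
    then obtain S where "S \<subseteq> R" "card S = 2" by (meson obtain_subset_with_card_n)
    then obtain c d where cd: "c \<in> R" "d \<in> R" "d \<noteq> c" by (auto simp: card_2_iff)
    then obtain g where g: "partial_colouring g" "card (uncoloured g) < card (uncoloured f)"
      "\<And>b. rare f b \<Longrightarrow> b \<notin> {c, d} \<Longrightarrow> rare g b"
      using augmentable_two_rare[OF less.prems(1) False, of c d] less.prems(3) unfolding augmentable_def by blast
    have "card (R - {c, d}) = card R - 2" using cd less.prems(2) by (simp add: card_Diff_subset)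
    then have "2 * card (uncoloured g) \<le> card (R - {c, d})" using g(2) less.prems(4) by simp
    then show ?thesis
      using less.hyps[OF g(2,1), of "R - {c, d}"] g(3) less.prems(2,3) by blast
  qed (use less.prems in blast)
qed

section \<open>A single rare colour\<close>

text \<open>
  In the next two lemmas \<open>S\<close> is a union of \<open>b\<close>-\<open>d\<close>-chains of the graph outside the triangle \<open>xyz\<close>
  that meets the triangle in a single vertex, namely \<open>x\<close>, respectively \<open>y\<close>. In the latter case \<open>b\<close>
  must first be exchanged, outside the triangle, with a colour that is missing at \<open>y\<close>.
\<close>

lemma exit_centre:
  assumes p: "fan_pair f u v y z c" and ne: "\<not> augmentable f UNIV"
    and b: "b \<in> missing f x"
    and d: "d < k" "d \<noteq> c" "\<And>e. e \<in> E \<Longrightarrow> ends e \<subseteq> {x, y, z} \<Longrightarrow> f e \<noteq> d"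
    and Sb: "\<And>e. e \<in> E \<Longrightarrow> ends e \<inter> {x, y, z} = {} \<Longrightarrow> f e = b \<Longrightarrow> ends e \<subseteq> S \<or> ends e \<inter> S = {}"
    and Sd: "\<And>e. e \<in> E \<Longrightarrow> f e = d \<Longrightarrow> ends e \<subseteq> S \<or> ends e \<inter> S = {}"
    and S: "x \<in> S" "y \<notin> S" "z \<notin> S"
  shows False
proof -
  note D = fan_pairD[OF p]
  have ne': "\<not> augmentable f {c}" using ne augmentable_mono by blast
  obtain h where h: "h \<in> E" "ends h = {y, z}" "f h = b" using miss_centre[OF p ne' b] by blast
  have bk: "b < k" using miss_less[OF b] .
  have bc: "b \<noteq> c" using missingD[OF b D(4)] D by auto
  \<comment> \<open>Since \<open>x\<close> misses \<open>b\<close>, only the \<open>b\<close>-edge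
    \<open>h\<close> meets the triangle, and \<open>h\<close> avoids \<open>S\<close>.\<close>
  have Sb': "ends e \<subseteq> S \<or> ends e \<inter> S = {}" if e: "e \<in> E" "f e = b" for e
  proof (cases "ends e \<inter> {x, y, z} = {}")
    case False
    moreover have "x \<notin> ends e" using missingD[OF b e(1)] e by auto
    ultimately have "e = h"
      using partial_colouring_eq[OF D(1) e(1) h(1), of y] partial_colouring_eq[OF D(1) e(1) h(1), of z] e h bk by auto
    then show ?thesis using h S by auto
  qed (use Sb e in blast)
  define F where "F = {e. ends e \<subseteq> S}"
  define g where "g = kswap F b d f"
  have "\<forall>e\<in>E \<inter> F. \<forall>e'\<in>E - F. ends e \<inter> ends e' \<noteq> {} \<longrightarrow> \<not> (f e \<in> {b, d} \<and> f e' \<in> {b, d})"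
    using Sb' Sd unfolding F_def by blast
  note g = kswap[OF D(1) bk d(1) this, folded g_def]
  have vF: "v \<notin> F" using D S by (auto simp: F_def)
  then have pg: "fan_pair g u v y z c"
    using D g bc d by (auto simp: fan_pair_def g_def kswap_def)
  have "augmentable f UNIV" if "augmentable g {c}" using augmentable_trans[OF that, of f UNIV] g(2) by auto
  then have neg: "\<not> augmentable g {c}" using ne by blast
  have "g e \<noteq> d" if e: "e \<in> E" "x \<in> ends e" for e
  proof (cases "e \<in> F")
    case True
    then show ?thesis using missingD[OF b e] D(1) by (auto simp: g_def kswap_def)
  next
    case False
    then show ?thesis using Sd[OF e(1)] e S by (auto simp: g_def kswap_def F_def)
  qed
  \<comment> \<open>Now \<open>miss_centre\<close> puts \<open>d\<close> on an edge joining
    \<open>y\<close> and \<open>z\<close>; the swap left that edge alone, contrary to the choice of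
    \<open>d\<close>.\<close>
  then have "d \<in> missing g x" using d(1) by (simp add: missing_def)
  then obtain h' where h': "h' \<in> E" "ends h' = {y, z}" "g h' = d"
    using miss_centre[OF pg neg] by blast
  then have "f h' = d" using S by (auto simp: g_def kswap_def F_def)
  then show False using d(3)[OF h'(1)] h' by auto
qed

lemma exit_tail:
  assumes p: "fan_pair f u v y z c" and ne: "\<not> augmentable f UNIV"
    and b: "b \<in> missing f x" and a: "a \<in> missing f y" "a \<noteq> c"
    and d: "d < k" "d \<noteq> c" "\<And>e. e \<in> E \<Longrightarrow> ends e \<subseteq> {x, y, z} \<Longrightarrow> f e \<noteq> d"
    and Sb: "\<And>e. e \<in> E \<Longrightarrow> ends e \<inter> {x, y, z} = {} \<Longrightarrow> f e = b \<Longrightarrow> ends e \<subseteq> S \<or> ends e \<inter> S = {}"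
    and Sd: "\<And>e. e \<in> E \<Longrightarrow> f e = d \<Longrightarrow> ends e \<subseteq> S \<or> ends e \<inter> S = {}"
    and S: "y \<in> S" "x \<notin> S" "z \<notin> S"
  shows False
proof -
  note D = fan_pairD[OF p]
  have ne': "\<not> augmentable f {c}" using ne augmentable_mono by blast
  obtain h where h: "h \<in> E" "ends h = {y, z}" "f h = b" using miss_centre[OF p ne' b] by blast
  obtain w where w: "w \<in> E" "ends w = {x, z}" "f w = a" using miss_tail[OF p ne' a] by blast
  have bk: "b < k" and ak: "a < k" using miss_less b a by auto
  have bc: "b \<noteq> c" using missingD[OF b D(4)] D by auto
  have db: "d \<noteq> b" and da: "d \<noteq> a" using d(3)[OF h(1)] h d(3)[OF w(1)] w by auto
  \<comment> \<open>Colour \<open>b\<close> meets the triangle only in \<open>h\<close> and colour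
    \<open>a\<close> only in \<open>w\<close>, so the two may be exchanged outside it.\<close>
  have inner: "ends e \<subseteq> {x, y, z}"
    if e: "e \<in> E" "f e \<in> {b, a}" "ends e \<inter> {x, y, z} \<noteq> {}" for e
  proof (cases "f e = b")
    case True
    then have "x \<notin> ends e" using missingD[OF b e(1)] by auto
    then have "e = h"
      using partial_colouring_eq[OF D(1) e(1) h(1), of y] partial_colouring_eq[OF D(1) e(1) h(1), of z] e h bk True by auto
    then show ?thesis using h by auto
  next
    case False
    then have fe: "f e = a" using e by auto
    then have "y \<notin> ends e" using missingD[OF a(1) e(1)] by auto
    then have "e = w"
      using partial_colouring_eq[OF D(1) e(1) w(1), of x] partial_colouring_eq[OF D(1) e(1) w(1), of z] e w ak fe by auto
    then show ?thesis using w by auto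
  qed
  define F where "F = {e. ends e \<inter> {x, y, z} = {}}"
  define g where "g = kswap F b a f"
  have "\<forall>e\<in>E \<inter> F. \<forall>e'\<in>E - F. ends e \<inter> ends e' \<noteq> {} \<longrightarrow> \<not> (f e \<in> {b, a} \<and> f e' \<in> {b, a})"
    using inner unfolding F_def by blast
  note g = kswap[OF D(1) bk ak this, folded g_def]
  \<comment> \<open>Off the triangle \<open>a\<close> has taken the place of \<open>b\<close>, and
    \<open>w\<close> avoids \<open>S\<close>; so \<open>S\<close> is a union of
    \<open>a\<close>-\<open>d\<close> chains of the whole graph.\<close>
  have ga: "ends e \<subseteq> S \<or> ends e \<inter> S = {}" if e: "e \<in> E" "g e = a" for e
  proof (cases "e \<in> F")
    case True
    then have "f e = b" using e by (auto simp: g_def kswap_def split: if_splits)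
    then show ?thesis using Sb e True by (auto simp: F_def)
  next
    case False
    then have fe: "f e = a" using e by (auto simp: g_def kswap_def)
    then have "y \<notin> ends e" using missingD[OF a(1) e(1)] by auto
    then show ?thesis using inner[OF e(1)] fe False S by (auto simp: F_def)
  qed
  have gd: "g e = d \<longleftrightarrow> f e = d" for e using da db by (auto simp: g_def kswap_def)
  define G where "G = {e. ends e \<subseteq> S}"
  define j where "j = kswap G a d g"
  have "\<forall>e\<in>E \<inter> G. \<forall>e'\<in>E - G. ends e \<inter> ends e' \<noteq> {} \<longrightarrow> \<not> (g e \<in> {a, d} \<and> g e' \<in> {a, d})"
    using ga Sd gd unfolding G_def by blast
  note j = kswap[OF g(1) ak d(1) this, folded j_def]
  have vF: "v \<notin> F" "v \<notin> G" using D S by (auto simp: F_def G_def)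
  have jv: "j v = c" using vF D(8) by (simp add: j_def g_def kswap_def)
  have pj: "fan_pair j u v y z c"
    using D j(1,2) g(2) j(3)[OF g(3)[OF D(9)]] bc d a jv unfolding fan_pair_def by auto
  have "augmentable f UNIV" if "augmentable j {c}" using augmentable_trans[OF that, of f UNIV] g(2) j(2) by auto
  then have nej: "\<not> augmentable j {c}" using ne by blast
  have "j e \<noteq> d" if e: "e \<in> E" "y \<in> ends e" for e
  proof (cases "e \<in> G")
    case True
    have "e \<notin> F" using e by (auto simp: F_def)
    then have "g e \<noteq> a" using missingD[OF a(1) e] by (auto simp: g_def kswap_def)
    then show ?thesis using True da by (auto simp: j_def kswap_def)
  next
    case False
    then show ?thesis using Sd[OF e(1)] e S gd by (auto simp: j_def kswap_def G_def)
  qed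
  \<comment> \<open>The swap on \<open>S\<close> makes \<open>y\<close> miss \<open>d\<close>
    instead of \<open>a\<close>; \<open>miss_tail\<close> then puts \<open>d\<close> on an edge
    joining \<open>x\<close> and \<open>z\<close>, which neither swap touched.\<close>
  then have "d \<in> missing j y" using d(1) by (simp add: missing_def)
  then obtain w' where w': "w' \<in> E" "ends w' = {x, z}" "j w' = d"
    using miss_tail[OF pj nej _ d(2)] by blast
  then have "f w' = d" using S gd by (auto simp: j_def kswap_def G_def)
  then show False using d(3)[OF w'(1)] w' by auto
qed

text \<open>A \<open>b\<close>-\<open>d\<close> chain from \<open>x\<close> that uses
  \<open>b\<close>-edges only off the triangle contains at most one of \<open>y\<close> and
  \<open>z\<close>. So either it or its complement meets the triangle in a single vertex, as the two
  exit lemmas need.\<close>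

lemma augmentable_one_rare_pair:
  assumes p: "fan_pair f u v y z c" and small: "\<And>v. card {e \<in> E. v \<in> ends e} < k"
  shows "augmentable f UNIV"
proof (rule ccontr)
  assume ne: "\<not> augmentable f UNIV"
  then have ne': "\<not> augmentable f {c}" using augmentable_mono by blast
  note D = fan_pairD[OF p]
  obtain d where d: "d < k" "d \<noteq> c" "\<And>e. e \<in> E \<Longrightarrow> ends e \<subseteq> {x, y, z} \<Longrightarrow> f e \<noteq> d"
    using leaving_colour[OF p ne'] by metis
  obtain b where b: "b \<in> missing f x" using miss_nonempty[OF D(2), of x] D(5) by blast
  \<comment> \<open>With degree below \<open>k\<close> and \<open>u\<close> uncoloured,
    \<open>y\<close> misses at least two colours.\<close>
  have "\<not> missing f y \<subseteq> {c}"
  proof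
    assume "missing f y \<subseteq> {c}"
    then have "card (missing f y) \<le> 1" using card_mono[of "{c}"] by force
    then show False
      using card_miss[of f y] card_coloured_star[OF D(2), of y] small[of y] D(5) by simp
  qed
  then obtain a where a: "a \<in> missing f y" "a \<noteq> c" by blast
  have "missing f z \<noteq> {}"
  proof
    assume "missing f z = {}"
    then have "k \<le> card {e \<in> E. z \<in> ends e \<and> f e < k}" using card_miss[of f z] by simp
    also have "\<dots> \<le> card {e \<in> E. z \<in> ends e}"
      using finite_edges by (intro card_mono) auto
    finally show False using small[of z] by simp
  qed
  then obtain a' where a': "a' \<in> missing f z" by blast
  have a'c: "a' \<noteq> c" using missingD[OF a' D(4)] D by auto
  let ?F = "{e \<in> E. ends e \<inter> {x, y, z} = {}}"
  obtain P where P: "x \<in> P"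
    "\<And>e. e \<in> ?F \<Longrightarrow> f e = b \<Longrightarrow> ends e \<subseteq> P \<or> ends e \<inter> P = {}"
    "\<And>e. e \<in> E \<Longrightarrow> f e = d \<Longrightarrow> ends e \<subseteq> P \<or> ends e \<inter> P = {}"
    "\<And>p q. \<lbrakk>p \<in> P; q \<in> P; p \<noteq> x; q \<noteq> x; \<forall>e\<in>?F. p \<in> ends e \<longrightarrow> f e \<noteq> b; \<forall>e\<in>?F. q \<in> ends e \<longrightarrow> f e \<noteq> b\<rbrakk> \<Longrightarrow> p = q"
  proof (rule kempe_set[OF D(1) miss_less[OF b] d(1), of ?F])
    show "?F \<subseteq> E" "\<forall>e\<in>?F. x \<in> ends e \<longrightarrow> f e \<noteq> b" by auto
  qed (use that in blast)
  \<comment> \<open>No edge of \<open>?F\<close> meets the triangle, so \<open>y\<close> and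
    \<open>z\<close> would both be further ends of the path.\<close>
  have not_both: "y \<notin> P \<or> z \<notin> P" using P(4)[of y z] D by auto
  show False
  proof (cases "y \<in> P \<or> z \<in> P")
    case False
    then show False using exit_centre[OF p ne b d _ P(3,1)] P(2) by blast
  next
    case yz: True
    have Q: "\<And>e. e \<in> E \<Longrightarrow> ends e \<inter> {x, y, z} = {} \<Longrightarrow> f e = b \<Longrightarrow> ends e \<subseteq> - P \<or> ends e \<inter> - P = {}"
      "\<And>e. e \<in> E \<Longrightarrow> f e = d \<Longrightarrow> ends e \<subseteq> - P \<or> ends e \<inter> - P = {}"
      using P(2,3) by blast+
    show False
    proof (cases "y \<in> P")
      case False
      then show False using exit_tail[OF p ne b a d Q] P(1) yz by blast
    next
      case True
      then have zP: "z \<notin> P" using not_both by blast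
      \<comment> \<open>The complement of \<open>P\<close> contains \<open>z\<close> but neither
        \<open>x\<close> nor \<open>y\<close>, so the fan is reversed to make \<open>z\<close> its
        tail.\<close>
      define g where "g = f(u := c, v := k)"
      note W = fan_pair_swap[OF p, folded g_def]
      have bc: "b \<noteq> c" using missingD[OF b D(4)] D by auto
      have same: "g e = q \<longleftrightarrow> f e = q" if "q < k" "q \<noteq> c" for e q
        using that D(2,8) by (auto simp: uncoloured_def g_def)
      have gb: "g e = b \<longleftrightarrow> f e = b" for e using same[OF miss_less[OF b] bc] .
      have gd: "g e = d \<longleftrightarrow> f e = d" for e using same[OF d(1,2)] .
      have xzy: "{x, z, y} = {x, y, z}" by blast
      show False
      proof (rule exit_tail[OF W(1) _ _ W(4)[OF a'] a'c d(1,2), of b "- P"])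
        show "\<not> augmentable g UNIV" using W(2) ne by blast
        show "b \<in> missing g x" using b by (simp add: missing_def gb)
        show "g e \<noteq> d" if "e \<in> E" "ends e \<subseteq> {x, z, y}" for e
          using d(3)[OF that(1)] that(2) unfolding gd xzy by blast
        show "ends e \<subseteq> - P \<or> ends e \<inter> - P = {}"
          if "e \<in> E" "ends e \<inter> {x, z, y} = {}" "g e = b" for e
          using Q(1)[OF that(1)] that(2,3) unfolding gb xzy by blast
        show "ends e \<subseteq> - P \<or> ends e \<inter> - P = {}" if "e \<in> E" "g e = d" for e
          using Q(2)[OF that(1)] that(2) unfolding gd by blast
      qed (use zP True P(1) in auto)
    qed
  qed
qed

lemma augmentable_one_rare:
  assumes "partial_colouring f" "uncoloured f \<noteq> {}" "rare f c" "\<And>v. card {e \<in> E. v \<in> ends e} < k"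
  shows "augmentable f UNIV"
  using assms(1-3)
proof (cases rule: fan_pair_exists)
  case (pair g u v y z)
  then show ?thesis using augmentable_one_rare_pair assms by blast
qed

section \<open>Deleting a star\<close>

lemma partial_colouring_proper:
  assumes "partial_colouring g" "uncoloured g = {}"
  shows "proper_colouring (line_graph E ends) k g"
  using assms unfolding proper_colouring_line_graph partial_colouring_def uncoloured_def
  by (metis (mono_tags, lifting) empty_Collect_eq not_le)

lemma initial_colouring:
  assumes Q: "Q \<subseteq> {e \<in> E. x \<in> ends e}" and "j \<le> k"
    and c: "proper_colouring (line_graph (E - Q) ends) j c"
  shows "\<exists>f. partial_colouring f \<and> card (uncoloured f) = card Q - (k - j) \<and> (\<forall>c\<in>{j..<k}. rare f c)"
proof -
  have "finite Q" using Q finite_edges finite_subset by fastforce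
  then obtain h where h: "bij_betw h Q {0..<card Q}" using ex_bij_betw_finite_nat by blast
  \<comment> \<open>The first \<open>k - j\<close> edges of \<open>Q\<close> get the fresh colours
    from \<open>j\<close> to \<open>k - 1\<close>; the others get values from \<open>k\<close> on
    and count as uncoloured.\<close>
  define f where "f e = (if e \<in> Q then j + h e else c e)" for e
  have cj: "c e < j" if "e \<in> E" "e \<notin> Q" for e
    using c that unfolding proper_colouring_line_graph by blast
  have inj: "h e = h e' \<Longrightarrow> e \<in> Q \<Longrightarrow> e' \<in> Q \<Longrightarrow> e = e'" for e e'
    using h unfolding bij_betw_def inj_on_def by blast
  have big: "e \<in> Q" if "e \<in> E" "j \<le> f e" for e
    using that cj[of e] by (cases "e \<in> Q") (auto simp: f_def)
  have "f e \<noteq> f e'" if "e \<in> E" "e' \<in> E" "e \<noteq> e'" "ends e \<inter> ends e' \<noteq> {}" for e e'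
  proof (cases "e \<in> Q \<longleftrightarrow> e' \<in> Q")
    case True
    then show ?thesis
      using that c inj[of e e'] unfolding proper_colouring_line_graph by (auto simp: f_def)
  next
    case False
    then show ?thesis using cj[OF that(1)] cj[OF that(2)] by (auto simp: f_def)
  qed
  then have pf: "partial_colouring f" using big Q \<open>j \<le> k\<close> unfolding partial_colouring_def
    by (metis (mono_tags, lifting) le_trans mem_Collect_eq subsetD)
  have rf: "rare f a" if "a \<in> {j..<k}" for a
    using that big Q by (auto simp: rare_def)
  have cf: "card (uncoloured f) = card Q - (k - j)"
  proof -
    have "uncoloured f = {e \<in> Q. k - j \<le> h e}"
      using big Q \<open>j \<le> k\<close> by (fastforce simp: uncoloured_def f_def)
    moreover have "h ` {e \<in> Q. k - j \<le> h e} = {k - j..<card Q}"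
      using h unfolding bij_betw_def by force
    moreover have "inj_on h {e \<in> Q. k - j \<le> h e}" using inj by (auto simp: inj_on_def)
    ultimately show ?thesis by (metis card_atLeastLessThan card_image)
  qed
  show ?thesis using pf cf rf by blast
qed

end

text \<open>If all degrees were below \<open>s\<close>, each edge would have at most
  \<open>2 * (s - 2)\<close> neighbours, fewer than \<open>k\<close>, and greedy colouring would
  succeed.\<close>

lemma large_star_exists:
  assumes G: "multigraph V E ends" and "2 * s \<le> k + 2" "1 \<le> s"
    and "\<nexists>c. proper_colouring (line_graph E ends) k c"
  obtains x where "s \<le> card {e \<in> E. x \<in> ends e}"
proof (rule ccontr)
  interpret multigraph V E ends by (rule G)
  assume nt: "\<not> thesis"
  have small: "card {e \<in> E. x \<in> ends e} < s" for x
  proof (rule ccontr)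
    assume "\<not> card {e \<in> E. x \<in> ends e} < s"
    then have "s \<le> card {e \<in> E. x \<in> ends e}" by simp
    from that[OF this] show False using nt by contradiction
  qed
  have "card {f \<in> E. f \<noteq> e \<and> ends e \<inter> ends f \<noteq> {}} < k" if e: "e \<in> E" for e
  proof -
    obtain a b where ab: "ends e = {a, b}" using card_ends[OF e] by (meson card_2_iff)
    let ?S = "\<lambda>v. {f \<in> E. v \<in> ends f} - {e}"
    have star: "card (?S v) + 2 \<le> s" if "v \<in> {a, b}" for v
    proof -
      have "e \<in> {f \<in> E. v \<in> ends f}" using \<open>e \<in> E\<close> ab that by auto
      then have "card (?S v) < card {f \<in> E. v \<in> ends f}"
        using finite_edges by (intro card_Diff1_less) auto
      then show ?thesis using small[of v] by simp
    qed
    have "{f \<in> E. f \<noteq> e \<and> ends e \<inter> ends f \<noteq> {}} \<subseteq> ?S a \<union> ?S b" using ab by auto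
    then have "card {f \<in> E. f \<noteq> e \<and> ends e \<inter> ends f \<noteq> {}} \<le> card (?S a \<union> ?S b)"
      using finite_edges by (intro card_mono) auto
    also have "\<dots> \<le> card (?S a) + card (?S b)" by (rule card_Un_le)
    finally show ?thesis using star[of a] star[of b] assms(2) by simp
  qed
  then show False
    using greedy_extension[of E "{}" ends k] assms(4) finite_edges
    by (auto simp: proper_colouring_line_graph)
qed

section \<open>Clique deletion over the natural numbers\<close>

lemma clique_deletion_nat:
  fixes s t l :: nat
  assumes G: "multigraph V E ends" and s: "7 * l + 4 \<le> 2 * s" "s \<le> t"
    and chi: "chromatic_number (line_graph E ends) = s + t - 1"
    and omega: "clique_number (line_graph E ends) < s + t - 1"
  shows "\<exists>Q. clique_of (line_graph E ends) Q \<and> card Q = s \<and>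
             t + l \<le> chromatic_number (delete_verts (line_graph E ends) Q)"
proof (rule ccontr)
  assume contr: "\<not> ?thesis"
  interpret multigraph V E ends by (rule G)
  \<comment> \<open>\<open>k\<close> is one colour too few for \<open>E\<close>, while by
    \<open>contr\<close> the number \<open>j\<close> suffices once a clique of size \<open>s\<close>
    is deleted.\<close>
  define k where "k = s + t - 2"
  define j where "j = t + l - 1"
  have jk: "j \<le> k" "k - j = s - l - 1" using s by (auto simp: j_def k_def)
  have no_col: "\<nexists>c. proper_colouring (line_graph E ends) k c"
    using chromatic_number_le[of "line_graph E ends" k] chi s unfolding k_def by fastforce
  have bounded: "clique_bounded_multigraph V E ends k"
  proof
    have le: "card Q \<le> k" if "clique_of (line_graph E ends) Q" for Q
      using card_le_clique_number[OF finite_edges that] omega unfolding k_def by simp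
    show "card {e \<in> E. v \<in> ends e} \<le> k" for v
      by (rule le) (auto simp: clique_of_line_graph)
    show "card {e \<in> E. ends e \<subseteq> {a, b, c}} \<le> k" for a b c
    proof (rule le)
      have "ends e \<inter> ends f \<noteq> {}" if "e \<in> E" "f \<in> E" "ends e \<subseteq> {a, b, c}" "ends f \<subseteq> {a, b, c}" for e f
      proof
        assume "ends e \<inter> ends f = {}"
        then have "card (ends e \<union> ends f) = 4"
          using that card_ends card_Un_disjoint[of "ends e" "ends f"]
          by (metis card_gt_0_iff numeral_Bit0 zero_less_numeral)
        moreover have "card (ends e \<union> ends f) \<le> card {a, b, c}"
          using that by (intro card_mono) auto
        moreover have "card {a, b, c} \<le> 3" by (simp add: card_insert_if)
        ultimately show False by simp
      qed
      then show "clique_of (line_graph E ends) {e \<in> E. ends e \<subseteq> {a, b, c}}"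
        by (auto simp: clique_of_line_graph)
    qed
  qed
  have colourable: "\<exists>c. proper_colouring (line_graph (E - Q) ends) j c"
    if "clique_of (line_graph E ends) Q" "card Q = s" for Q
  proof -
    have "\<not> t + l \<le> chromatic_number (line_graph (E - Q) ends)"
      using contr that by (auto simp: delete_verts_line_graph)
    then have "chromatic_number (line_graph (E - Q) ends) \<le> j" by (simp add: j_def)
    then show ?thesis using line_graph_colouring finite_edges by (metis finite_Diff)
  qed
  obtain x where x: "s \<le> card {e \<in> E. x \<in> ends e}"
  proof (rule large_star_exists[OF G _ _ no_col])
    show "2 * s \<le> k + 2" "1 \<le> s" using s by (auto simp: k_def)
  qed
  interpret clique_bounded_multigraph V E ends k x by (rule bounded)
  obtain Q where Q: "Q \<subseteq> {e \<in> E. x \<in> ends e}" "card Q = s"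
    using x by (meson obtain_subset_with_card_n)
  have "clique_of (line_graph E ends) Q" using Q(1) by (auto simp: clique_of_line_graph)
  then obtain c where "proper_colouring (line_graph (E - Q) ends) j c" using colourable Q(2) by blast
  from initial_colouring[OF Q(1) jk(1) this] Q(2)
  obtain f where f: "partial_colouring f" "card (uncoloured f) = s - (k - j)" "\<And>c. c \<in> {j..<k} \<Longrightarrow> rare f c"
    by blast
  have unc_f: "card (uncoloured f) = l + 1" using f(2) jk(2) s by simp
  show False
  proof (cases "l = 0 \<and> s = 2")
    case False
    then have "2 * card (uncoloured f) \<le> card {j..<k}" using unc_f jk s by auto
    then show False using complete_colouring[OF f(1) _ f(3)] partial_colouring_proper no_col by blast
  next
    case True
    then have kt: "k = t" and jt: "j = t - 1" by (auto simp: k_def j_def)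
    show False
    proof (cases "\<exists>z. card {e \<in> E. z \<in> ends e} = k")
      case False
      then have "card {e \<in> E. v \<in> ends e} < k" for v using star_le[of v] by (metis le_neq_implies_less)
      moreover have "uncoloured f \<noteq> {}" using unc_f by auto
      moreover have "rare f j" using f(3)[of j] jk True by simp
      ultimately have "augmentable f UNIV" using augmentable_one_rare f(1) by blast
      then obtain g where "partial_colouring g" "card (uncoloured g) < card (uncoloured f)" unfolding augmentable_def by blast
      moreover from this have "uncoloured g = {}" using unc_f True by simp
      ultimately show False using partial_colouring_proper no_col by blast
    next
      case True
      then obtain z where z: "card {e \<in> E. z \<in> ends e} = k" by blast
      let ?S = "{e \<in> E. z \<in> ends e}"
      \<comment> \<open>Two adjacent edges avoiding \<open>z\<close> form a clique of size
        \<open>s = 2\<close>; deleting it leaves \<open>k\<close> edges at \<open>z\<close>, one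
        more than the \<open>j\<close> colours.\<close>
      have matching: False
        if e: "e \<in> E" "f \<in> E" "e \<noteq> f" "ends e \<inter> ends f \<noteq> {}" "z \<notin> ends e" "z \<notin> ends f" for e f
      proof -
        have "clique_of (line_graph E ends) {e, f}" "card {e, f} = s"
          using e \<open>l = 0 \<and> s = 2\<close> by (auto simp: clique_of_line_graph)
        then obtain c where c: "proper_colouring (line_graph (E - {e, f}) ends) j c"
          using colourable by blast
        have sub: "?S \<subseteq> E - {e, f}" using e by auto
        then have "inj_on c ?S" using c unfolding proper_colouring_line_graph inj_on_def by blast
        moreover have "c ` ?S \<subseteq> {..<j}" using c sub unfolding proper_colouring_line_graph by blast
        ultimately have "card ?S \<le> card {..<j}" by (intro card_inj_on_le) auto
        then show False using z kt jt s \<open>l = 0 \<and> s = 2\<close> by simp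
      qed
      obtain h where h: "bij_betw h ?S {0..<k}"
        using ex_bij_betw_finite_nat[of ?S] finite_edges z by auto
      have "proper_colouring (line_graph ?S ends) k h"
        using h unfolding proper_colouring_line_graph bij_betw_def inj_on_def by fastforce
      moreover have "card {f \<in> E. f \<noteq> e \<and> ends e \<inter> ends f \<noteq> {}} < k" if e: "e \<in> E - ?S" for e
      proof -
        obtain a b where ab: "ends e = {a, b}" using card_ends e by (meson DiffD1 card_2_iff)
        let ?T = "{f \<in> E. ends f \<subseteq> {a, b, z}}"
        \<comment> \<open>Edges avoiding \<open>z\<close> form a matching, so every neighbour of
          \<open>e\<close> contains \<open>z\<close> and lies in the triangle on \<open>a\<close>,
          \<open>b\<close>, \<open>z\<close>. This has at most \<open>k\<close> edges,
          \<open>e\<close> among them, so the colouring of the star at \<open>z\<close> extends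
          greedily.\<close>
        have "f \<in> ?T - {e}" if f: "f \<in> E" "f \<noteq> e" "ends e \<inter> ends f \<noteq> {}" for f
        proof -
          have "z \<in> ends f" using matching[of e f] e f by auto
          then obtain w where "ends f = {z, w}" "w \<noteq> z" using ends_pair f(1) by metis
          then show ?thesis using f ab e by auto
        qed
        then have "card {f \<in> E. f \<noteq> e \<and> ends e \<inter> ends f \<noteq> {}} \<le> card (?T - {e})"
          using finite_edges by (intro card_mono) auto
        also have "\<dots> < card ?T" using finite_edges e ab by (intro card_Diff1_less) auto
        also have "\<dots> \<le> k" by (rule triangle_le)
        finally show ?thesis .
      qed
      ultimately show False using greedy_extension[OF finite_edges _, of ?S] no_col by blast
    qed
  qed
qed

theorem theorem1:
  fixes s t l :: int
    and V :: "'v set" and E :: "'e set" and ends :: "'e \<Rightarrow> 'v set"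
  assumes "l \<ge> 0"
    and "3.5 * real_of_int l + 2 \<le> real_of_int s" and "s \<le> t"
    and "multigraph V E ends"
    and "int (chromatic_number (line_graph E ends)) = s + t - 1"
    and "s + t - 1 > int (clique_number (line_graph E ends))"
  shows "\<exists>Q. clique_of (line_graph E ends) Q \<and> int (card Q) = s \<and>
             int (chromatic_number (delete_verts (line_graph E ends) Q)) \<ge> t + l"
proof -
  have "7 * real_of_int l + 4 \<le> 2 * real_of_int s" using assms(2) by simp
  then have ls: "7 * l + 4 \<le> 2 * s" by linarith
  have "\<exists>Q. clique_of (line_graph E ends) Q \<and> card Q = nat s \<and>
           nat t + nat l \<le> chromatic_number (delete_verts (line_graph E ends) Q)"
  proof (rule clique_deletion_nat[OF assms(4)])
    show "7 * nat l + 4 \<le> 2 * nat s" "nat s \<le> nat t" using ls assms(1,3) by auto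
    show "chromatic_number (line_graph E ends) = nat s + nat t - 1"
      "clique_number (line_graph E ends) < nat s + nat t - 1"
      using ls assms(1,3,5,6) by auto
  qed
  then obtain Q where Q: "clique_of (line_graph E ends) Q" "card Q = nat s"
    "nat t + nat l \<le> chromatic_number (delete_verts (line_graph E ends) Q)" by blast
  then have "int (card Q) = s"
    "t + l \<le> int (chromatic_number (delete_verts (line_graph E ends) Q))"
    using ls assms(1,3) by linarith+
  then show ?thesis using Q(1) by blast
qed

end
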